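(* Let $p,q,r$ be non-zero integers such that $p$ and $q$ are relatively prime, $|p|\geq q\geq 1$, $r\geq 2$, and $r$ is even. Let $D$ be the standard diagram of the torus link $T(pr,qr)$, i.e. the closure of the braid diagram $B(pr,qr)$, and let $A^{(4)}\subset(\mathbb{Z}^r)^q$ be the set of all $(\boldsymbol{a}_1,\dots,\boldsymbol{a}_q)\in(\mathbb{Z}^r)^q$ such that the assignment of $\boldsymbol{a}_1,\dots,\boldsymbol{a}_q$ to the families $\boldsymbol{x}_1,\dots,\boldsymbol{x}_q$ of left-end arcs of $B(pr,qr)$ defines a $\mathbb{Z}$-coloring of $D$ whose set of colors (image) is exactly $\{0,1,2,3\}$. Then \[ A^{(4)}=\left\{(\boldsymbol{a},\dots,\boldsymbol{a})\;\middle|\;\boldsymbol{a}\in A^{(4)}_{01}\cup A^{(4)}_{12}\cup A^{(4)}_{23}\right\}\setminus\{(1,\dots,1),(2,\dots,2)\}, \] where $(1,\dots,1)$ and $(2,\dots,2)$ denote the constant $qr$-tuples and \begin{align*} A^{(4)}_{01}&=\left\{(a_1,\dots,a_r)\in\{0,1\}^r \;\middle|\; a_1=a_r=1,\ a_{2i}=a_{2i+1}\ (i=1,\dots,r/2-1)\right\},\\ A^{(4)}_{12}&=\left\{(a_1,\dots,a_r)\in\{1,2\}^r \;\middle|\; a_{2i-1}=a_{2i}\ (i=1,\dots,r/2)\right\},\\ A^{(4)}_{23}&=\left\{(a_1,\dots,a_r)\in\{2,3\}^r \;\middle|\; a_1=a_r=2,\ a_{2i}=a_{2i+1}\ (i=1,\dots,r/2-1)\right\}.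 \end{align*}
   Context: A $\mathbb{Z}$-coloring of a link diagram (or braid diagram) is a map $\gamma:\{\text{arcs}\}\to\mathbb{Z}$ such that $2\gamma(a)=\gamma(b)+\gamma(c)$ at each crossing with over arc $a$ and under arcs $b$ and $c$. The torus link $T(a,b)$ is the link on the standardly embedded torus in 3-space running $a$ times meridionally and $b$ times longitudinally. For $a,b\geq 1$, let $B(a,b)$ be the braid diagram on $b$ horizontal strands (positions numbered $1,\dots,b$ from top to bottom) obtained by concatenating, from left to right, $a$ copies of the elementary braid diagram in which the strand in position $1$ passes over all the other $b-1$ strands to position $b$, while each other strand moves up by one position without the other strands crossing each other. (Thus, in a $\mathbb{Z}$-coloring, one elementary braid changes the colors $(c_1,\dots,c_b)$ of its left ends to $(2c_1-c_2,\dots,2c_1-c_b,c_1)$ at its right ends.) For $a\leq -1$, $B(a,b)$ is the diagram of the inverse braid, i.e. the reflection of $B(|a|,b)$ in a vertical line. The standard diagram of $T(a,b)$ is the closure of $B(a,b)$. An assignment of colors to the $b$ left ends of $B(a,b)$ determines a unique $\mathbb{Z}$-coloring of $B(a,b)$; it defines a $\mathbb{Z}$-coloring of the closure if and only if the resulting colors of the right ends coincide with those of the left ends. The $qr$ arcs at the left end of $B(pr,qr)$ are divided, from top to bottom, into $q$ families $\boldsymbol{x}_1,\dots,\boldsymbol{x}_q$ of $r$ consecutive arcs each: $\boldsymbol{x}_i=(x_{i,1},\dots,x_{i,r})$, where $x_{i,j}$ is the arc in position $(i-1)r+j$. Assigning $\boldsymbol{a}_i=(a_{i,1},\dots,a_{i,r})$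 to $\boldsymbol{x}_i$ means giving $x_{i,j}$ the color $a_{i,j}$. Elements of $(\mathbb{Z}^r)^q$ are identified with $qr$-tuples of integers. *)

theory Defs
  imports Main
begin

text \<open>
  A link diagram enters only through its arcs and, for each crossing, the triple
  (over arc, under arc, under arc).
\<close>

record 'arc diagram =
  arcs :: "'arc set"
  crossings :: "('arc \<times> 'arc \<times> 'arc) set"

definition Z_coloring :: "'arc diagram \<Rightarrow> ('arc \<Rightarrow> int) \<Rightarrow> bool" where
  "Z_coloring D \<gamma> \<longleftrightarrow> (\<forall>(a, b, c) \<in> crossings D. 2 * \<gamma> a = \<gamma> b + \<gamma> c)"

text \<open>
  A braid diagram is the list, from left to right, of its crossings.  Each crossing exchanges the
  strands in positions \<open>k\<close> and \<open>k + 1\<close>, counted from the top starting with 1.  The over strand runs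
  from \<open>k\<close> (left) to \<open>k + 1\<close> (right) in \<open>Over_Down k\<close>, and from \<open>k + 1\<close> to \<open>k\<close> in \<open>Over_Up k\<close>.
\<close>

datatype braid_crossing = Over_Down nat | Over_Up nat

fun crossing_pos :: "braid_crossing \<Rightarrow> nat" where
  "crossing_pos (Over_Down k) = k"
| "crossing_pos (Over_Up k) = k"

fun over_left :: "braid_crossing \<Rightarrow> nat" where
  "over_left (Over_Down k) = k"
| "over_left (Over_Up k) = k + 1"

fun over_right :: "braid_crossing \<Rightarrow> nat" where
  "over_right (Over_Down k) = k + 1"
| "over_right (Over_Up k) = k"

fun under_left :: "braid_crossing \<Rightarrow> nat" where
  "under_left (Over_Down k) = k + 1"
| "under_left (Over_Up k) = k"

fun under_right :: "braid_crossing \<Rightarrow> nat" where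
  "under_right (Over_Down k) = k"
| "under_right (Over_Up k) = k + 1"

fun reflect_crossing :: "braid_crossing \<Rightarrow> braid_crossing" where
  "reflect_crossing (Over_Down k) = Over_Up k"
| "reflect_crossing (Over_Up k) = Over_Down k"

text \<open>Reflection in a vertical line of the plane, which preserves over and under.\<close>

definition reflect_braid :: "braid_crossing list \<Rightarrow> braid_crossing list" where
  "reflect_braid w = rev (map reflect_crossing w)"

text \<open>The strand in position 1 passes over all the others, one after the other, to position \<open>b\<close>.\<close>

definition elementary_braid :: "nat \<Rightarrow> braid_crossing list" where
  "elementary_braid b = map Over_Down [1..<b]"

definition torus_braid :: "int \<Rightarrow> nat \<Rightarrow> braid_crossing list" where
  "torus_braid a b =
     (let w = concat (replicate (nat \<bar>a\<bar>) (elementary_braid b))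
      in if a \<ge> 0 then w else reflect_braid w)"

text \<open>
  Cut the strands of a braid diagram by vertical lines numbered \<open>0, \<dots>, length w\<close>, with
  the crossing \<open>w ! t\<close> between the lines \<open>t\<close> and \<open>t + 1\<close>.  The point \<open>(t, j)\<close> is the intersection of
  line \<open>t\<close> with the strand that is in position \<open>j\<close> there.
\<close>

definition braid_points :: "nat \<Rightarrow> braid_crossing list \<Rightarrow> (nat \<times> nat) set" where
  "braid_points b w = {0..length w} \<times> {1..b}"

text \<open>
  Pairs of points that are joined in the closure by a piece of strand without undercrossing
  (\<open>closing\<close> is given by the closing strands).
\<close>

inductive_set joined :: "nat \<Rightarrow> braid_crossing list \<Rightarrow> ((nat \<times> nat) \<times> (nat \<times> nat)) set"
  for b :: nat and w :: "braid_crossing list" where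
  straight: "t < length w \<Longrightarrow> j \<in> {1..b} \<Longrightarrow>
      j \<noteq> crossing_pos (w ! t) \<Longrightarrow> j \<noteq> crossing_pos (w ! t) + 1 \<Longrightarrow>
      ((t, j), (t + 1, j)) \<in> joined b w"
| over: "t < length w \<Longrightarrow> ((t, over_left (w ! t)), (t + 1, over_right (w ! t))) \<in> joined b w"
| closing: "j \<in> {1..b} \<Longrightarrow> ((length w, j), (0, j)) \<in> joined b w"

text \<open>Arcs of the closure, represented by the sets of points lying on them.\<close>

definition same_arc :: "nat \<Rightarrow> braid_crossing list \<Rightarrow> ((nat \<times> nat) \<times> (nat \<times> nat)) set" where
  "same_arc b w = (joined b w \<union> (joined b w)\<inverse>)\<^sup>*"

definition arc_at :: "nat \<Rightarrow> braid_crossing list \<Rightarrow> nat \<times> nat \<Rightarrow> (nat \<times> nat) set" where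
  "arc_at b w P = same_arc b w `` {P}"

definition braid_closure :: "nat \<Rightarrow> braid_crossing list \<Rightarrow> (nat \<times> nat) set diagram" where
  "braid_closure b w =
     \<lparr> arcs = braid_points b w // same_arc b w,
       crossings = {(arc_at b w (t, over_left (w ! t)),
                     arc_at b w (t, under_left (w ! t)),
                     arc_at b w (t + 1, under_right (w ! t))) | t. t < length w} \<rparr>"

definition torus_diagram :: "int \<Rightarrow> nat \<Rightarrow> (nat \<times> nat) set diagram" where
  "torus_diagram a b = braid_closure b (torus_braid a b)"

definition left_end_arc :: "int \<Rightarrow> nat \<Rightarrow> nat \<Rightarrow> (nat \<times> nat) set" where
  "left_end_arc a b k = arc_at b (torus_braid a b) (0, k)"

text \<open>Tuples are lists; \<open>entry a i\<close> is the \<open>i\<close>-th entry counted from 1.\<close>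

abbreviation entry :: "'a list \<Rightarrow> nat \<Rightarrow> 'a" where
  "entry a i \<equiv> a ! (i - 1)"

definition A4 :: "int \<Rightarrow> nat \<Rightarrow> nat \<Rightarrow> int list list set" where
  "A4 p q r = {as. length as = q \<and> (\<forall>a \<in> set as. length a = r) \<and>
     (\<exists>\<gamma>. Z_coloring (torus_diagram (p * int r) (q * r)) \<gamma> \<and>
          (\<forall>i \<in> {1..q}. \<forall>j \<in> {1..r}.
             \<gamma> (left_end_arc (p * int r) (q * r) ((i - 1) * r + j)) = entry (entry as i) j) \<and>
          \<gamma> ` arcs (torus_diagram (p * int r) (q * r)) = {0, 1, 2, 3})}"

definition A4_01 :: "nat \<Rightarrow> int list set" where
  "A4_01 r = {a. length a = r \<and> set a \<subseteq> {0, 1} \<and> entry a 1 = 1 \<and> entry a r = 1 \<and>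
     (\<forall>i \<in> {1..r div 2 - 1}. entry a (2 * i) = entry a (2 * i + 1))}"

definition A4_12 :: "nat \<Rightarrow> int list set" where
  "A4_12 r = {a. length a = r \<and> set a \<subseteq> {1, 2} \<and>
     (\<forall>i \<in> {1..r div 2}. entry a (2 * i - 1) = entry a (2 * i))}"

definition A4_23 :: "nat \<Rightarrow> int list set" where
  "A4_23 r = {a. length a = r \<and> set a \<subseteq> {2, 3} \<and> entry a 1 = 2 \<and> entry a r = 2 \<and>
     (\<forall>i \<in> {1..r div 2 - 1}. entry a (2 * i) = entry a (2 * i + 1))}"

end

theory Submission imports Defs begin

text \<open>
  Let \<open>s\<^sub>c\<close> be the reflection \<open>x \<mapsto> 2 c - x\<close> of the integers. One elementary braid on \<open>b\<close> strands
  rotates the tuple of colors cyclically by one place and then applies \<open>s\<^sub>c\<close> to all of it, where \<open>c\<close>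
  is the color at the top. Because the reflection in \<open>s\<^sub>c x\<close> is \<open>s\<^sub>c s\<^sub>x s\<^sub>c\<close>, these steps telescope:
  if \<open>d\<close> is the cyclic sequence of left-end colors, then after \<open>m\<close> elementary braids the color in
  position \<open>j\<close> is the image of \<open>d (j - 1 + m)\<close> under the composition of the reflections in
  \<open>d 0, \<dots>, d (m - 1)\<close>. This composition is \<open>x \<mapsto> 2 S\<^sub>m + (-1)\<^sup>m x\<close> with the alternating sum
  \<open>S\<^sub>m = d 0 - d 1 + d 2 - \<dots>\<close> of length \<open>m\<close> (\<open>elementary_power_eq\<close>).

  For \<open>p > 0\<close> and even \<open>r\<close> the whole braid is therefore a rotation by \<open>p r\<close> places followed by a
  translation. If it fixes the tuple, then going round \<open>q\<close> times shows that the translation is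
  trivial. Hence \<open>d\<close> has period \<open>p r\<close>, and with its period \<open>q r\<close> and the coprimality of \<open>p\<close> and \<open>q\<close>
  also period \<open>r\<close>. So the colorings of the closure are the tuples \<open>(a, \<dots>, a)\<close> with \<open>S\<^sub>r = 0\<close>
  (\<open>closing_iff\<close>), and their colors are the integers \<open>2 S\<^sub>m + (-1)\<^sup>m x\<close> with \<open>m < r\<close> and \<open>x\<close> an
  entry of \<open>a\<close> (\<open>A4_positive\<close>). A coloring read from right to left is a coloring of the reflected
  diagram, which gives the case \<open>p < 0\<close> (\<open>A4_abs\<close>).

  It remains to see when this set of colors is \<open>{0, 1, 2, 3}\<close> (\<open>palette_eq_iff\<close>). Then \<open>a\<close> is not
  constant. If \<open>S\<^sub>m = 0\<close> for all even \<open>m\<close>, then every entry occurs as \<open>S\<^sub>m\<close> for some odd \<open>m\<close>, so the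
  set of entries and all its reflections in its own elements lie between 0 and 3; this forces the
  entries 1 and 2. Otherwise some translate of the set of entries by \<open>2 S\<^sub>m \<noteq> 0\<close> also lies between
  0 and 3, so the entries are 0 and 1, or 2 and 3, and the bounds for odd \<open>m\<close> leave only \<open>S\<^sub>m = 1\<close>,
  respectively \<open>S\<^sub>m = 2\<close>. The values of \<open>S\<^sub>m\<close> at all even or at all odd \<open>m\<close> translate into the
  pairings of equal neighbours that define the three families.
\<close>

section \<open>Colorings of a braid closure as functions on points\<close>

text \<open>
  The colorings of the closure, pulled back to the points that represent the arcs. In this form a
  coloring can be computed along the braid without choosing representatives of arcs.
\<close>

definition point_coloring :: "nat \<Rightarrow> braid_crossing list \<Rightarrow> (nat \<times> nat \<Rightarrow> int) \<Rightarrow> bool" where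
  "point_coloring b w g \<longleftrightarrow>
     (\<forall>(P, Q) \<in> joined b w. g P = g Q) \<and>
     (\<forall>t < length w. 2 * g (t, over_left (w ! t)) =
        g (t, under_left (w ! t)) + g (t + 1, under_right (w ! t)))"

lemma equiv_same_arc: "equiv UNIV (same_arc b w)"
proof -
  have "sym (joined b w \<union> (joined b w)\<inverse>)"
    by (auto simp: sym_def)
  then show ?thesis
    unfolding same_arc_def
    by (intro equivI) (auto intro: refl_rtrancl sym_rtrancl trans_rtrancl)
qed

lemma arc_at_eq_iff: "arc_at b w P = arc_at b w Q \<longleftrightarrow> (P, Q) \<in> same_arc b w"
  unfolding arc_at_def by (rule eq_equiv_class_iff[OF equiv_same_arc]) auto

lemma joined_same_arc: "(P, Q) \<in> joined b w \<Longrightarrow> (P, Q) \<in> same_arc b w"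
  unfolding same_arc_def by blast

lemma point_coloring_same_arc:
  assumes "point_coloring b w g" "(P, Q) \<in> same_arc b w"
  shows "g P = g Q"
  using assms(2) unfolding same_arc_def
proof (induction rule: rtrancl_induct)
  case base
  then show ?case by simp
next
  case (step Q R)
  then show ?case
    using assms(1) unfolding point_coloring_def by fastforce
qed

lemma point_coloring_of_Z_coloring:
  assumes "Z_coloring (braid_closure b w) \<gamma>"
  shows "point_coloring b w (\<lambda>P. \<gamma> (arc_at b w P))"
proof -
  have "\<gamma> (arc_at b w P) = \<gamma> (arc_at b w Q)" if "(P, Q) \<in> joined b w" for P Q
    using joined_same_arc[OF that] arc_at_eq_iff by metis
  moreover have "2 * \<gamma> (arc_at b w (t, over_left (w ! t))) =
      \<gamma> (arc_at b w (t, under_left (w ! t))) + \<gamma> (arc_at b w (t + 1, under_right (w ! t)))"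
    if "t < length w" for t
    using assms that unfolding Z_coloring_def braid_closure_def by fastforce
  ultimately show ?thesis
    unfolding point_coloring_def by blast
qed

lemma Z_coloring_of_point_coloring:
  assumes "point_coloring b w g"
  obtains \<gamma> where "Z_coloring (braid_closure b w) \<gamma>" "\<And>P. \<gamma> (arc_at b w P) = g P"
proof -
  define \<gamma> where "\<gamma> = (\<lambda>A. g (SOME P. arc_at b w P = A))"
  have \<gamma>: "\<gamma> (arc_at b w P) = g P" for P
  proof -
    have "arc_at b w (SOME Q. arc_at b w Q = arc_at b w P) = arc_at b w P"
      by (rule someI) simp
    then show ?thesis
      unfolding \<gamma>_def using point_coloring_same_arc[OF assms] arc_at_eq_iff by metis
  qed
  moreover have "Z_coloring (braid_closure b w) \<gamma>"
    using assms unfolding point_coloring_def Z_coloring_def braid_closure_def by (auto simp: \<gamma>)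
  ultimately show ?thesis using that by blast
qed

lemma image_arcs_braid_closure:
  "\<gamma> ` arcs (braid_closure b w) = (\<lambda>P. \<gamma> (arc_at b w P)) ` braid_points b w"
  unfolding braid_closure_def quotient_def arc_at_def by auto

text \<open>
  Position \<open>(i - 1) r + j\<close> carries the \<open>j\<close>-th color of the \<open>i\<close>-th family, both counted from 1.
\<close>

definition left_colors :: "nat \<Rightarrow> int list list \<Rightarrow> nat \<Rightarrow> int" where
  "left_colors r as k = as ! ((k - 1) div r) ! ((k - 1) mod r)"

lemma left_colors_eq_iff:
  assumes "r \<ge> 1"
  shows "(\<forall>i \<in> {1..q}. \<forall>j \<in> {1..r}. h ((i - 1) * r + j) = entry (entry as i) j) \<longleftrightarrow>
    (\<forall>k \<in> {1..q * r}. h k = left_colors r as k)" (is "?L \<longleftrightarrow> ?R")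
proof
  assume L: ?L
  show ?R
  proof
    fix k assume k: "k \<in> {1..q * r}"
    define i j where "i = (k - 1) div r + 1" and "j = (k - 1) mod r + 1"
    have "(k - 1) div r < q"
      using k by (intro less_mult_imp_div_less) auto
    moreover have "(i - 1) * r + j = k"
      using k by (simp add: i_def j_def)
    ultimately show "h k = left_colors r as k"
      using L[rule_format, of i j] assms by (auto simp: i_def j_def left_colors_def Suc_le_eq)
  qed
next
  assume R: ?R
  show ?L
  proof (intro ballI)
    fix i j assume i: "i \<in> {1..q}" and j: "j \<in> {1..r}"
    define l where "l = j - 1"
    have l: "l < r" "j = Suc l" using j by (auto simp: l_def)
    have "(i - 1) * r + r = i * r"
      using i by (cases i) auto
    also have "\<dots> \<le> q * r"
      using i by simp
    finally have "(i - 1) * r + j \<in> {1..q * r}"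
      using j by auto
    then have "h ((i - 1) * r + j) = left_colors r as ((i - 1) * r + j)"
      using R by blast
    also have "\<dots> = entry (entry as i) j"
      using l(1) by (simp add: left_colors_def l(2))
    finally show "h ((i - 1) * r + j) = entry (entry as i) j" .
  qed
qed

lemma A4_iff_point_coloring:
  assumes "r \<ge> 1"
  shows "as \<in> A4 p q r \<longleftrightarrow> length as = q \<and> (\<forall>a \<in> set as. length a = r) \<and>
    (\<exists>g. point_coloring (q * r) (torus_braid (p * int r) (q * r)) g \<and>
      (\<forall>k \<in> {1..q * r}. g (0, k) = left_colors r as k) \<and>
      g ` braid_points (q * r) (torus_braid (p * int r) (q * r)) = {0, 1, 2, 3})"
proof -
  let ?b = "q * r" and ?w = "torus_braid (p * int r) (q * r)"
  have "(\<exists>\<gamma>. Z_coloring (braid_closure ?b ?w) \<gamma> \<and>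
      (\<forall>k \<in> {1..?b}. \<gamma> (arc_at ?b ?w (0, k)) = left_colors r as k) \<and>
      (\<lambda>P. \<gamma> (arc_at ?b ?w P)) ` braid_points ?b ?w = {0, 1, 2, 3}) \<longleftrightarrow>
    (\<exists>g. point_coloring ?b ?w g \<and> (\<forall>k \<in> {1..?b}. g (0, k) = left_colors r as k) \<and>
      g ` braid_points ?b ?w = {0, 1, 2, 3})" (is "?L \<longleftrightarrow> ?R")
  proof
    assume ?L
    then obtain \<gamma> where "Z_coloring (braid_closure ?b ?w) \<gamma>"
      "\<forall>k \<in> {1..?b}. \<gamma> (arc_at ?b ?w (0, k)) = left_colors r as k"
      "(\<lambda>P. \<gamma> (arc_at ?b ?w P)) ` braid_points ?b ?w = {0, 1, 2, 3}" by blast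
    then show ?R
      by (intro exI[of _ "\<lambda>P. \<gamma> (arc_at ?b ?w P)"] conjI point_coloring_of_Z_coloring)
  next
    assume ?R
    then obtain g where g: "point_coloring ?b ?w g"
      "\<forall>k \<in> {1..?b}. g (0, k) = left_colors r as k"
      "g ` braid_points ?b ?w = {0, 1, 2, 3}" by blast
    obtain \<gamma> where "Z_coloring (braid_closure ?b ?w) \<gamma>" "\<And>P. \<gamma> (arc_at ?b ?w P) = g P"
      using Z_coloring_of_point_coloring[OF g(1)] by blast
    with g(2,3) show ?L by (intro exI[of _ \<gamma>]) simp
  qed
  moreover have "(\<forall>i \<in> {1..q}. \<forall>j \<in> {1..r}.
      \<gamma> (arc_at ?b ?w (0, (i - 1) * r + j)) = entry (entry as i) j) \<longleftrightarrow>
    (\<forall>k \<in> {1..?b}. \<gamma> (arc_at ?b ?w (0, k)) = left_colors r as k)" for \<gamma>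
    using left_colors_eq_iff[OF assms] .
  ultimately show ?thesis
    unfolding A4_def torus_diagram_def left_end_arc_def mem_Collect_eq image_arcs_braid_closure
    by (simp only:)
qed

section \<open>Reflection\<close>

lemma reflect_crossing_simps [simp]:
  "crossing_pos (reflect_crossing x) = crossing_pos x"
  "over_left (reflect_crossing x) = over_right x"
  "over_right (reflect_crossing x) = over_left x"
  "under_left (reflect_crossing x) = under_right x"
  "under_right (reflect_crossing x) = under_left x"
  "reflect_crossing (reflect_crossing x) = x"
  by (cases x; simp)+

lemma length_reflect_braid [simp]: "length (reflect_braid w) = length w"
  by (simp add: reflect_braid_def)

lemma reflect_braid_nth:
  "t < length w \<Longrightarrow> reflect_braid w ! t = reflect_crossing (w ! (length w - Suc t))"
  by (simp add: reflect_braid_def rev_nth)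

lemma reflect_reflect_braid [simp]: "reflect_braid (reflect_braid w) = w"
  by (simp add: reflect_braid_def rev_map comp_def)

lemma torus_braid_uminus:
  "a \<noteq> 0 \<Longrightarrow> torus_braid (- a) b = reflect_braid (torus_braid a b)"
  by (simp add: torus_braid_def Let_def)

text \<open>
  The relation at a crossing is symmetric in its two under arcs, and the over strand has the same
  color on both sides; so a coloring stays a coloring when the vertical lines are read from right to
  left.
\<close>

lemma point_coloring_reflect:
  assumes "point_coloring b w g"
  shows "point_coloring b (reflect_braid w) (\<lambda>(t, j). g (length w - t, j))"
  unfolding point_coloring_def
proof (intro conjI)
  have J: "g P = g Q" if "(P, Q) \<in> joined b w" for P Q
    using assms that unfolding point_coloring_def by blast
  have C: "2 * g (t, over_left (w ! t)) = g (t, under_left (w ! t)) + g (t + 1, under_right (w ! t))"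
    if "t < length w" for t
    using assms that unfolding point_coloring_def by blast
  show "\<forall>(P, Q) \<in> joined b (reflect_braid w).
    (case P of (t, j) \<Rightarrow> g (length w - t, j)) = (case Q of (t, j) \<Rightarrow> g (length w - t, j))"
  proof (clarify)
    fix t j t' j' assume "((t, j), (t', j')) \<in> joined b (reflect_braid w)"
    then show "g (length w - t, j) = g (length w - t', j')"
    proof cases
      case straight
      then show ?thesis
        using J[OF joined.straight[of "length w - Suc t" w j b]]
        by (simp add: reflect_braid_nth Suc_diff_Suc)
    next
      case over
      then show ?thesis
        using J[OF joined.over[of "length w - Suc t" w b]]
        by (simp add: reflect_braid_nth Suc_diff_Suc)
    next
      case closing
      then show ?thesis
        using J[OF joined.closing[of j b w]] by simp
    qed
  qed
  show "\<forall>t < length (reflect_braid w).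
    2 * (case (t, over_left (reflect_braid w ! t)) of (t, j) \<Rightarrow> g (length w - t, j)) =
    (case (t, under_left (reflect_braid w ! t)) of (t, j) \<Rightarrow> g (length w - t, j)) +
    (case (t + 1, under_right (reflect_braid w ! t)) of (t, j) \<Rightarrow> g (length w - t, j))"
  proof (intro allI impI)
    fix t assume "t < length (reflect_braid w)"
    then have t: "t < length w" by simp
    define s where "s = length w - Suc t"
    have s: "s < length w" "length w - t = s + 1" "length w - (t + 1) = s"
      using t by (auto simp: s_def)
    show "2 * (case (t, over_left (reflect_braid w ! t)) of (t, j) \<Rightarrow> g (length w - t, j)) =
      (case (t, under_left (reflect_braid w ! t)) of (t, j) \<Rightarrow> g (length w - t, j)) +
      (case (t + 1, under_right (reflect_braid w ! t)) of (t, j) \<Rightarrow> g (length w - t, j))"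
      using C[OF s(1)] J[OF joined.over[OF s(1), of b]]
      by (simp only: prod.case s reflect_braid_nth[OF t] s_def[symmetric] reflect_crossing_simps)
  qed
qed

text \<open>
  The reflected coloring has the old right ends as its left ends. In the closure they carry the same
  colors as the old left ends.
\<close>

lemma A4_subset_A4_uminus:
  assumes "p \<noteq> 0" "r \<ge> 1"
  shows "A4 p q r \<subseteq> A4 (- p) q r"
proof
  let ?b = "q * r" and ?w = "torus_braid (p * int r) (q * r)"
  fix as assume as: "as \<in> A4 p q r"
  then obtain g where g: "point_coloring ?b ?w g"
    "\<forall>k \<in> {1..?b}. g (0, k) = left_colors r as k"
    "g ` braid_points ?b ?w = {0, 1, 2, 3}"
    unfolding A4_iff_point_coloring[OF assms(2)] by blast
  have w: "torus_braid (- p * int r) (q * r) = reflect_braid ?w"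
    using assms torus_braid_uminus[of "p * int r"] by simp
  let ?g = "\<lambda>(t, j). g (length ?w - t, j)"
  have "\<forall>k \<in> {1..?b}. ?g (0, k) = left_colors r as k"
  proof
    fix k assume k: "k \<in> {1..?b}"
    then have "g (length ?w, k) = g (0, k)"
      using g(1) joined.closing[OF k, of ?w] unfolding point_coloring_def by blast
    then show "?g (0, k) = left_colors r as k" using g(2) k by simp
  qed
  moreover have "?g ` braid_points ?b (reflect_braid ?w) = g ` braid_points ?b ?w"
  proof -
    have "(\<lambda>(t, j). (length ?w - t, j)) ` braid_points ?b ?w = braid_points ?b ?w"
    proof (intro equalityI subsetI)
      fix P assume "P \<in> braid_points ?b ?w"
      then have "P = (\<lambda>(t, j). (length ?w - t, j)) (length ?w - fst P, snd P)"
        "(length ?w - fst P, snd P) \<in> braid_points ?b ?w"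
        by (auto simp: braid_points_def)
      then show "P \<in> (\<lambda>(t, j). (length ?w - t, j)) ` braid_points ?b ?w" by blast
    qed (auto simp: braid_points_def)
    moreover have "?g = g \<circ> (\<lambda>(t, j). (length ?w - t, j))" by auto
    moreover have "braid_points ?b (reflect_braid ?w) = braid_points ?b ?w"
      by (simp add: braid_points_def)
    ultimately show ?thesis by (metis image_comp)
  qed
  ultimately show "as \<in> A4 (- p) q r"
    using as point_coloring_reflect[OF g(1)] g(3)
    unfolding A4_iff_point_coloring[OF assms(2)] w by (intro conjI exI[of _ ?g]) auto
qed

lemma A4_abs:
  assumes "p \<noteq> 0" "r \<ge> 1"
  shows "A4 p q r = A4 \<bar>p\<bar> q r"
  using A4_subset_A4_uminus[of p r q] A4_subset_A4_uminus[of "- p" r q] assms by (auto simp: abs_if)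

section \<open>Transport of colors along a braid\<close>

text \<open>
  The effect of one crossing on the colors of all positions; the color of the outgoing under strand
  is forced by the coloring relation.
\<close>

definition crossing_map :: "braid_crossing \<Rightarrow> (nat \<Rightarrow> int) \<Rightarrow> nat \<Rightarrow> int" where
  "crossing_map x c =
     c(over_right x := c (over_left x), under_right x := 2 * c (over_left x) - c (under_left x))"

lemma right_positions:
  "{over_right x, under_right x} = {crossing_pos x, crossing_pos x + 1}"
  "over_right x \<noteq> under_right x"
  by (cases x; auto)+

lemma point_coloring_transport:
  assumes g: "point_coloring b w g"
    and w: "\<forall>x \<in> set w. 1 \<le> crossing_pos x \<and> crossing_pos x < b"
    and c: "\<forall>j \<in> {1..b}. g (0, j) = c j"
  shows "t \<le> length w \<Longrightarrow> j \<in> {1..b} \<Longrightarrow> g (t, j) = fold crossing_map (take t w) c j"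
proof (induction t arbitrary: j)
  case 0
  then show ?case using c by simp
next
  case (Suc t)
  define x where "x = w ! t"
  define d where "d = fold crossing_map (take t w) c"
  have t: "t < length w" using Suc.prems by simp
  have step: "fold crossing_map (take (Suc t) w) c = crossing_map x d"
    using t by (simp add: take_Suc_conv_app_nth x_def d_def)
  have x: "1 \<le> crossing_pos x" "crossing_pos x < b"
    using w t unfolding x_def by auto
  then have "over_left x \<in> {1..b}" "under_left x \<in> {1..b}"
    by (cases x; auto)+
  then have IH: "g (t, over_left x) = d (over_left x)" "g (t, under_left x) = d (under_left x)"
    using Suc.IH t unfolding d_def by auto
  have J: "g P = g Q" if "(P, Q) \<in> joined b w" for P Q
    using g that unfolding point_coloring_def by blast
  consider "j = under_right x" | "j = over_right x" "j \<noteq> under_right x"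
    | "j \<noteq> crossing_pos x" "j \<noteq> crossing_pos x + 1" "j \<noteq> over_right x" "j \<noteq> under_right x"
    using right_positions(1)[of x] by blast
  then have "g (Suc t, j) = crossing_map x d j"
  proof cases
    case 1
    have "2 * g (t, over_left x) = g (t, under_left x) + g (t + 1, under_right x)"
      using g t unfolding point_coloring_def x_def by blast
    then show ?thesis
      using 1 IH by (simp add: crossing_map_def)
  next
    case 2
    then show ?thesis
      using J[OF joined.over[OF t]] IH by (simp add: crossing_map_def x_def)
  next
    case 3
    then have "g (t, j) = g (Suc t, j)"
      using J[OF joined.straight[OF t Suc.prems(2)]] unfolding x_def by simp
    then show ?thesis
      using Suc.IH[of j, folded d_def] Suc.prems 3 t by (simp add: crossing_map_def)
  qed
  then show ?case by (simp only: step)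
qed

lemma point_coloring_fold:
  assumes "\<forall>j \<in> {1..b}. fold crossing_map w c j = c j"
  shows "point_coloring b w (\<lambda>(t, j). fold crossing_map (take t w) c j)"
  unfolding point_coloring_def
proof (intro conjI)
  have step: "fold crossing_map (take (Suc t) w) c =
      crossing_map (w ! t) (fold crossing_map (take t w) c)" if "t < length w" for t
    using that by (simp add: take_Suc_conv_app_nth)
  show "\<forall>(P, Q) \<in> joined b w. (case P of (t, j) \<Rightarrow> fold crossing_map (take t w) c j) =
    (case Q of (t, j) \<Rightarrow> fold crossing_map (take t w) c j)"
  proof (clarify)
    fix t j t' j' assume "((t, j), (t', j')) \<in> joined b w"
    then show "fold crossing_map (take t w) c j = fold crossing_map (take t' w) c j'"
    proof cases
      case straight
      then have "j \<noteq> over_right (w ! t)" "j \<noteq> under_right (w ! t)"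
        using right_positions(1)[of "w ! t"] by auto
      with straight show ?thesis by (simp add: step crossing_map_def)
    next
      case over
      then show ?thesis
        using right_positions(2)[of "w ! t"] by (simp add: step crossing_map_def)
    next
      case closing
      then show ?thesis using assms by simp
    qed
  qed
qed (simp add: step crossing_map_def take_Suc_conv_app_nth)

definition trace_colors :: "nat \<Rightarrow> braid_crossing list \<Rightarrow> (nat \<Rightarrow> int) \<Rightarrow> int set" where
  "trace_colors b w c = (\<Union>t \<le> length w. fold crossing_map (take t w) c ` {1..b})"

text \<open>
  The colors at the left ends determine the coloring of the open braid, so a coloring of the closure
  exists exactly when transporting these colors through the braid reproduces them.
\<close>

lemma ex_point_coloring_iff:
  assumes w: "\<forall>x \<in> set w. 1 \<le> crossing_pos x \<and> crossing_pos x < b"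
  shows "(\<exists>g. point_coloring b w g \<and> (\<forall>k \<in> {1..b}. g (0, k) = c k) \<and> g ` braid_points b w = S) \<longleftrightarrow>
    (\<forall>k \<in> {1..b}. fold crossing_map w c k = c k) \<and> trace_colors b w c = S" (is "?L \<longleftrightarrow> ?R")
proof
  assume ?L
  then obtain g where g: "point_coloring b w g" "\<forall>k \<in> {1..b}. g (0, k) = c k"
    "g ` braid_points b w = S" by blast
  note tr = point_coloring_transport[OF g(1) w g(2)]
  have "fold crossing_map w c k = c k" if k: "k \<in> {1..b}" for k
  proof -
    have "g (length w, k) = g (0, k)"
      using g(1) joined.closing[OF k, of w] unfolding point_coloring_def by blast
    then show ?thesis using tr[of "length w" k] tr[of 0 k] k by simp
  qed
  moreover have "g ` braid_points b w = trace_colors b w c"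
    unfolding trace_colors_def braid_points_def using tr by (force simp: image_iff)
  ultimately show ?R using g(3) by simp
next
  assume R: ?R
  have "(\<lambda>(t, j). fold crossing_map (take t w) c j) ` braid_points b w = trace_colors b w c"
    unfolding trace_colors_def braid_points_def by (force simp: image_iff)
  moreover have "point_coloring b w (\<lambda>(t, j). fold crossing_map (take t w) c j)"
    using R by (intro point_coloring_fold) blast
  ultimately show ?L
    using R by (intro exI[of _ "\<lambda>(t, j). fold crossing_map (take t w) c j"]) simp
qed

lemma trace_colors_Nil [simp]: "trace_colors b [] c = c ` {1..b}"
  by (simp add: trace_colors_def)

lemma trace_colors_append:
  "trace_colors b (u @ v) c = trace_colors b u c \<union> trace_colors b v (fold crossing_map u c)"
proof -
  have "{..length (u @ v)} = {..length u} \<union> (+) (length u) ` {..length v}"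
  proof (intro equalityI subsetI)
    fix t assume t: "t \<in> {..length (u @ v)}"
    show "t \<in> {..length u} \<union> (+) (length u) ` {..length v}"
    proof (cases "t \<le> length u")
      case False
      then have "t = length u + (t - length u)" "t - length u \<le> length v" using t by auto
      then show ?thesis by blast
    qed simp
  qed auto
  then show ?thesis
    unfolding trace_colors_def by simp
qed

section \<open>The elementary braid and its powers\<close>

text \<open>
  Positions beyond \<open>b\<close>, and position 0, keep their colors. In this way the same formula with
  \<open>k\<close> in place of \<open>b\<close> describes the first \<open>k - 1\<close> crossings of the elementary braid on more strands.
\<close>

definition elementary_map :: "nat \<Rightarrow> (nat \<Rightarrow> int) \<Rightarrow> nat \<Rightarrow> int" where
  "elementary_map b c j =
     (if j < 1 \<or> b < j then c j else if j = b then c 1 else 2 * c 1 - c (j + 1))"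

lemma fold_elementary_prefix:
  "k \<ge> 1 \<Longrightarrow> fold crossing_map (map Over_Down [1..<k]) c = elementary_map k c"
proof (induction k rule: nat_induct_at_least)
  case base
  have "elementary_map 1 c j = c j" for j
    by (cases "j = 1") (auto simp: elementary_map_def)
  then show ?case by auto
next
  case (Suc k)
  then show ?case
    by (auto simp: fun_eq_iff crossing_map_def elementary_map_def)
qed

text \<open>
  Inside an elementary braid each under strand changes color once and the over strand never, so the
  colors between its first and its last line already occur on one of these two lines.
\<close>

lemma trace_colors_elementary_prefix:
  assumes "k \<ge> 1" "k \<le> b"
  shows "trace_colors b (map Over_Down [1..<k]) c =
    c ` {1..b} \<union> elementary_map k c ` {1..b}"
  using assms
proof (induction k rule: nat_induct_at_least)
  case base
  have "elementary_map 1 c = c" using fold_elementary_prefix[of 1 c] by simp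
  then show ?case by simp
next
  case (Suc k)
  have "trace_colors b [Over_Down k] d = d ` {1..b} \<union> crossing_map (Over_Down k) d ` {1..b}" for d
    by (auto simp: trace_colors_def le_Suc_eq)
  then have "trace_colors b (map Over_Down [1..<Suc k]) c =
      c ` {1..b} \<union> elementary_map k c ` {1..b} \<union> elementary_map (Suc k) c ` {1..b}"
    using Suc fold_elementary_prefix[of k c] fold_elementary_prefix[of "Suc k" c]
    by (simp add: trace_colors_append Un_assoc)
  moreover have "elementary_map k c ` {1..b} \<subseteq> c ` {1..b} \<union> elementary_map (Suc k) c ` {1..b}"
  proof
    fix y assume "y \<in> elementary_map k c ` {1..b}"
    then obtain j where j: "j \<in> {1..b}" "y = elementary_map k c j" by blast
    consider "j < k" | "j = k" | "j > k" by linarith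
    then show "y \<in> c ` {1..b} \<union> elementary_map (Suc k) c ` {1..b}"
    proof cases
      case 1
      then have "y = elementary_map (Suc k) c j" using j by (auto simp: elementary_map_def)
      then show ?thesis using j by blast
    next
      case 2
      then have "y = c 1" using j by (auto simp: elementary_map_def)
      then show ?thesis using j by auto
    next
      case 3
      then have "y = c j" using j by (auto simp: elementary_map_def)
      then show ?thesis using j by auto
    qed
  qed
  ultimately show ?case by blast
qed

lemma fold_elementary_power:
  assumes "b \<ge> 1"
  shows "fold crossing_map (concat (replicate n (elementary_braid b))) c = (elementary_map b ^^ n) c"
  using fold_elementary_prefix[OF assms]
  by (induction n arbitrary: c) (simp_all add: elementary_braid_def funpow_swap1)

lemma trace_colors_elementary_power:
  assumes "b \<ge> 1"
  shows "trace_colors b (concat (replicate n (elementary_braid b))) c =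
    (\<Union>m \<le> n. (elementary_map b ^^ m) c ` {1..b})"
proof (induction n arbitrary: c)
  case 0
  then show ?case by simp
next
  case (Suc n)
  have "trace_colors b (concat (replicate (Suc n) (elementary_braid b))) c =
      c ` {1..b} \<union> elementary_map b c ` {1..b} \<union>
      (\<Union>m \<le> n. (elementary_map b ^^ m) (elementary_map b c) ` {1..b})"
    using Suc.IH trace_colors_elementary_prefix[OF assms, of b c] fold_elementary_prefix[OF assms]
    by (simp add: trace_colors_append elementary_braid_def)
  also have "\<dots> = c ` {1..b} \<union>
      (\<Union>m \<le> n. (elementary_map b ^^ Suc m) c ` {1..b})"
    by (force simp: funpow_swap1)
  also have "\<dots> = (\<Union>m \<le> Suc n. (elementary_map b ^^ m) c ` {1..b})"
    by (simp add: atMost_Suc_eq_insert_0 image_image)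
  finally show ?case .
qed

definition alt_sum :: "(nat \<Rightarrow> int) \<Rightarrow> nat \<Rightarrow> int" where
  "alt_sum d m = (\<Sum>i<m. (-1) ^ i * d i)"

lemma alt_sum_0 [simp]: "alt_sum d 0 = 0"
  and alt_sum_Suc [simp]: "alt_sum d (Suc m) = alt_sum d m + (-1) ^ m * d m"
  by (simp_all add: alt_sum_def)

text \<open>
  With \<open>S\<^sub>m = alt_sum d m\<close>, the color at the top of line \<open>m\<close> is \<open>2 S\<^sub>m + (-1)\<^sup>m d m\<close>, and reflecting
  \<open>2 S\<^sub>m + (-1)\<^sup>m x\<close> in it gives \<open>2 (S\<^sub>m + (-1)\<^sup>m d m) - (-1)\<^sup>m x\<close>, the same expression for \<open>m + 1\<close>.
  The last position receives the top color itself, which its own reflection fixes.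
\<close>

lemma elementary_power_eq:
  assumes "b \<ge> 1" and d: "\<And>i. d i = c (i mod b + 1)"
  shows "j \<in> {1..b} \<Longrightarrow>
    (elementary_map b ^^ m) c j = 2 * alt_sum d m + (-1) ^ m * d (j - 1 + m)"
proof (induction m arbitrary: j)
  case 0
  then show ?case by (auto simp: d)
next
  case (Suc m)
  have 1: "(elementary_map b ^^ m) c 1 = 2 * alt_sum d m + (-1) ^ m * d m"
    using Suc.IH[of 1] assms(1) by simp
  show ?case
  proof (cases "j = b")
    case True
    have wrap: "j - 1 + Suc m = m + b" using True assms(1) by simp
    have "d (j - 1 + Suc m) = d m" unfolding wrap d by simp
    then show ?thesis
      using True 1 assms(1) by (simp add: elementary_map_def[of _ "(elementary_map b ^^ m) c"])
  next
    case False
    then have "(elementary_map b ^^ m) c (j + 1) = 2 * alt_sum d m + (-1) ^ m * d (j + m)"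
      using Suc.IH[of "j + 1"] Suc.prems by simp
    moreover have "j - 1 + Suc m = j + m" using Suc.prems by simp
    ultimately show ?thesis
      using False 1 Suc.prems by (simp add: elementary_map_def[of _ "(elementary_map b ^^ m) c"])
  qed
qed

section \<open>Closing the braid\<close>

text \<open>With \<open>s = 0\<close> this says that multiples of a period are periods.\<close>

lemma shift_mult:
  fixes d :: "nat \<Rightarrow> int"
  assumes "\<And>i. d (i + M) + s = d i"
  shows "d (i + k * M) + int k * s = d i"
proof (induction k)
  case (Suc k)
  then show ?case using assms[of "i + k * M"] by (simp add: algebra_simps)
qed simp

lemma alt_sum_add_period:
  assumes "even r" "\<And>i. d (i + r) = d i"
  shows "alt_sum d (m + r) = alt_sum d m + alt_sum d r"
proof (induction m)
  case (Suc m)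
  then show ?case using assms by (simp add: power_add)
qed simp

lemma alt_sum_mult_period:
  assumes "even r" "\<And>i. d (i + r) = d i"
  shows "alt_sum d (k * r) = int k * alt_sum d r"
proof (induction k)
  case (Suc k)
  then show ?case
    using alt_sum_add_period[of r d "k * r"] assms by (simp add: algebra_simps)
qed simp

text \<open>
  Going \<open>q\<close> times round shifts the index by a multiple of the period \<open>q r\<close>, so the total translation
  by \<open>q\<close> times \<open>2 * alt_sum d (P * r)\<close> vanishes. A Bezout relation between \<open>P\<close> and \<open>q\<close> then turns the
  periods \<open>P r\<close> and \<open>q r\<close> into the period \<open>r\<close>, over which the alternating sum is added up \<open>P\<close> times.
\<close>

lemma closing_iff:
  fixes d :: "nat \<Rightarrow> int"
  assumes "coprime P q" "P \<ge> 1" "q \<ge> 1" "even r" and per: "\<And>i. d (i + q * r) = d i"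
  shows "(\<forall>i. 2 * alt_sum d (P * r) + d (i + P * r) = d i) \<longleftrightarrow>
    (\<forall>i. d (i + r) = d i) \<and> alt_sum d r = 0" (is "?L \<longleftrightarrow> ?R")
proof
  assume L: ?L
  let ?s = "2 * alt_sum d (P * r)"
  have "d (0 + q * (P * r)) + int q * ?s = d 0"
    by (rule shift_mult) (use L in \<open>simp add: add.commute\<close>)
  moreover have "d (0 + P * (q * r)) + int P * 0 = d 0"
    by (rule shift_mult) (simp add: per)
  ultimately have s: "alt_sum d (P * r) = 0"
    using assms(3) by (simp add: mult.left_commute)
  obtain x y where xy: "P * x = q * y + 1"
    using bezout_nat[of P q] assms(1,2) by (auto simp: coprime_iff_gcd_eq_1)
  have r: "d (i + r) = d i" for i
  proof -
    have "d (i + r + y * (q * r)) + int y * 0 = d (i + r)"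
      by (rule shift_mult) (simp add: per)
    moreover have "d (i + x * (P * r)) + int x * 0 = d i"
      by (rule shift_mult) (use L s in simp)
    moreover have "i + r + y * (q * r) = i + x * (P * r)"
    proof -
      have "x * (P * r) = (P * x) * r" by simp
      also have "\<dots> = r + y * (q * r)" unfolding xy by (simp add: algebra_simps)
      finally show ?thesis by simp
    qed
    ultimately show ?thesis by simp
  qed
  moreover have "alt_sum d r = 0"
    using alt_sum_mult_period[of r d P] r s assms(2,4) by simp
  ultimately show ?R by blast
next
  assume R: ?R
  then have "d (i + P * r) + int P * 0 = d i" for i
    by (intro shift_mult) simp
  moreover have "alt_sum d (P * r) = 0"
    using alt_sum_mult_period[of r d P] R assms(4) by simp
  ultimately show ?L by simp
qed

text \<open>
  The images of the entries of \<open>a\<close> under the compositions of the reflections in its first \<open>m\<close> entries.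
\<close>

definition palette :: "int list \<Rightarrow> int set" where
  "palette a = {2 * alt_sum ((!) a) m + (-1) ^ m * x | m x. m < length a \<and> x \<in> set a}"

lemma alt_sum_cong: "(\<And>i. i < m \<Longrightarrow> d i = e i) \<Longrightarrow> alt_sum d m = alt_sum e m"
  by (simp add: alt_sum_def)

lemma left_colors_replicate:
  assumes "k < q * r" "r \<ge> 1"
  shows "left_colors r (replicate q a) (k + 1) = a ! (k mod r)"
  using assms by (simp add: left_colors_def less_mult_imp_div_less)

text \<open>
  When the alternating sum over one period vanishes, \<open>alt_sum d m\<close> and \<open>(-1) ^ m\<close> depend only on
  \<open>m mod r\<close>. Hence the first \<open>r\<close> lines already show all colors, and on each of them every entry of
  \<open>a\<close> appears.
\<close>

lemma colors_replicate_eq_palette: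
  assumes a: "length a = r" "even r" "r \<ge> 1" and "q \<ge> 1" "r \<le> M"
    and d: "\<And>i. d i = a ! (i mod r)" and 0: "alt_sum ((!) a) r = 0"
  shows "{2 * alt_sum d m + (-1) ^ m * d (j - 1 + m) | m j. m \<le> M \<and> j \<in> {1..q * r}} = palette a"
proof -
  have per: "d (i + r) = d i" for i by (simp add: d)
  have alt: "alt_sum d m = alt_sum ((!) a) m" if "m \<le> r" for m
    using that by (intro alt_sum_cong) (simp add: d)
  have alt_mod: "alt_sum d m = alt_sum ((!) a) (m mod r)" for m
  proof -
    have "alt_sum d (m mod r + (m div r) * r) = alt_sum d (m mod r) + alt_sum d ((m div r) * r)"
      by (rule alt_sum_add_period) (use a(2) shift_mult[of d r 0 _ "m div r"] per in auto)
    then show ?thesis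
      using alt_sum_mult_period[of r d "m div r"] a(2,3) per alt[of r] alt[of "m mod r"] 0
      by (simp add: less_imp_le)
  qed
  have sgn: "(-1) ^ m = ((-1) ^ (m mod r) :: int)" for m
    using a(2) by (simp add: uminus_power_if dvd_mod_iff)
  show ?thesis
  proof (intro equalityI subsetI)
    fix y assume "y \<in> {2 * alt_sum d m + (-1) ^ m * d (j - 1 + m) | m j. m \<le> M \<and> j \<in> {1..q * r}}"
    then obtain m j where "y = 2 * alt_sum d m + (-1) ^ m * d (j - 1 + m)" by blast
    then have "y = 2 * alt_sum ((!) a) (m mod r) + (-1) ^ (m mod r) * a ! ((j - 1 + m) mod r)"
      using sgn[of m] by (simp add: alt_mod d)
    then show "y \<in> palette a"
      using a unfolding palette_def
      by (intro CollectI exI[of _ "m mod r"] exI[of _ "a ! ((j - 1 + m) mod r)"]) simp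
  next
    fix y assume "y \<in> palette a"
    then obtain m x where y: "y = 2 * alt_sum ((!) a) m + (-1) ^ m * x" "m < r" "x \<in> set a"
      using a unfolding palette_def by auto
    then obtain i where i: "i < r" "x = a ! i" using a by (auto simp: in_set_conv_nth)
    \<comment> \<open>The position at which line \<open>m\<close> shows the entry with index \<open>i\<close>.\<close>
    define j where "j = (i + (r - m)) mod r + 1"
    have "(j - 1 + m) mod r = (i + (r - m) + m) mod r"
      unfolding j_def by (simp add: mod_simps)
    also have "\<dots> = i" using y(2) i by simp
    finally have "d (j - 1 + m) = x" using d i by simp
    moreover have "r \<le> q * r" using assms(4) by simp
    then have "j \<in> {1..q * r}"
      using a(3) mod_less_divisor[of r "i + (r - m)"] unfolding j_def atLeastAtMost_iff by linarith
    ultimately show "y \<in> {2 * alt_sum d m + (-1) ^ m * d (j - 1 + m) | m j. m \<le> M \<and> j \<in> {1..q * r}}"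
      using y assms(5) alt[of m] by (intro CollectI exI[of _ m] exI[of _ j]) auto
  qed
qed

lemma A4_positive:
  fixes P q r :: nat
  assumes "coprime P q" "P \<ge> 1" "q \<ge> 1" "even r" "r \<ge> 2"
  shows "A4 (int P) q r =
    {replicate q a | a. length a = r \<and> alt_sum ((!) a) r = 0 \<and> palette a = {0, 1, 2, 3}}"
proof (intro set_eqI)
  fix as
  let ?b = "q * r"
  define w where "w = concat (replicate (P * r) (elementary_braid ?b))"
  have b: "?b \<ge> 1" using assms by simp
  have tb: "torus_braid (int P * int r) (q * r) = w"
    by (simp add: torus_braid_def w_def nat_mult_distrib)
  have pos: "\<forall>x \<in> set w. 1 \<le> crossing_pos x \<and> crossing_pos x < ?b"
    by (auto simp: w_def elementary_braid_def)
  define c where "c = left_colors r as"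
  define d where "d = (\<lambda>i. c (i mod ?b + 1))"
  have per: "d (i + q * r) = d i" for i by (simp add: d_def)
  have pow: "(elementary_map ?b ^^ m) c j = 2 * alt_sum d m + (-1) ^ m * d (j - 1 + m)"
    if "j \<in> {1..?b}" for m j
    using elementary_power_eq[OF b _ that, of d c m] by (simp add: d_def)
  have closed: "(\<forall>k \<in> {1..?b}. fold crossing_map w c k = c k) \<longleftrightarrow>
    (\<forall>i. d (i + r) = d i) \<and> alt_sum d r = 0"
  proof -
    have "(\<forall>k \<in> {1..?b}. fold crossing_map w c k = c k) \<longleftrightarrow>
      (\<forall>k \<in> {1..?b}. 2 * alt_sum d (P * r) + d (k - 1 + P * r) = d (k - 1))"
      using pow[of _ "P * r"] assms(4) unfolding w_def fold_elementary_power[OF b]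
      by (intro ball_cong) (auto simp: d_def)
    also have "\<dots> \<longleftrightarrow> (\<forall>i. 2 * alt_sum d (P * r) + d (i + P * r) = d i)"
    proof (intro iffI allI ballI)
      fix i assume *: "\<forall>k \<in> {1..?b}. 2 * alt_sum d (P * r) + d (k - 1 + P * r) = d (k - 1)"
      have "i mod ?b + 1 \<in> {1..?b}"
        using mod_less_divisor[of ?b i] b by (simp add: Suc_le_eq)
      then have "2 * alt_sum d (P * r) + d (i mod ?b + P * r) = d (i mod ?b)"
        using * by force
      then show "2 * alt_sum d (P * r) + d (i + P * r) = d i"
        by (simp add: d_def mod_simps)
    qed blast
    finally show ?thesis using closing_iff[OF assms(1-4), of d] per by simp
  qed
  have trace: "trace_colors ?b w c =
      {2 * alt_sum d m + (-1) ^ m * d (j - 1 + m) | m j. m \<le> P * r \<and> j \<in> {1..?b}}"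
    unfolding w_def trace_colors_elementary_power[OF b] using pow by (force simp: image_iff)
  have iff: "as \<in> A4 (int P) q r \<longleftrightarrow> length as = q \<and> (\<forall>a \<in> set as. length a = r) \<and>
      ((\<forall>i. d (i + r) = d i) \<and> alt_sum d r = 0) \<and> trace_colors ?b w c = {0, 1, 2, 3}"
    using A4_iff_point_coloring[of r as "int P" q] ex_point_coloring_iff[OF pos, of c] assms(5)
    unfolding tb closed c_def[symmetric] by simp
  have rep: "alt_sum d r = alt_sum ((!) a) r \<and> (\<forall>i. d (i + r) = d i) \<and>
      (alt_sum ((!) a) r = 0 \<longrightarrow> trace_colors ?b w c = palette a)"
    if as: "as = replicate q a" "length a = r" for a
  proof -
    have d: "d i = a ! (i mod r)" for i
    proof -
      have "i mod ?b < q * r" using b by simp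
      then have "d i = a ! (i mod ?b mod r)"
        using left_colors_replicate[of "i mod ?b" q r a] assms(5) unfolding d_def c_def as by simp
      then show ?thesis by (simp add: mod_mod_cancel)
    qed
    have "alt_sum d r = alt_sum ((!) a) r" by (intro alt_sum_cong) (simp add: d)
    moreover have "r \<le> P * r" using assms(2) by simp
    ultimately show ?thesis
      using colors_replicate_eq_palette[of a r q "P * r" d] as(2) assms d trace by simp
  qed
  show "as \<in> A4 (int P) q r \<longleftrightarrow> as \<in>
    {replicate q a | a. length a = r \<and> alt_sum ((!) a) r = 0 \<and> palette a = {0, 1, 2, 3}}"
  proof
    assume as: "as \<in> A4 (int P) q r"
    define a where "a = as ! 0"
    have len: "length as = q" "length a = r"
      using as assms(3) unfolding iff a_def by auto
    have "as = replicate q a"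
    proof (rule nth_equalityI)
      fix i assume "i < length as"
      then have i: "i < q" using len by simp
      show "as ! i = replicate q a ! i"
      proof (rule nth_equalityI)
        show "length (as ! i) = length (replicate q a ! i)"
          using as i len unfolding iff by simp
        fix j assume "j < length (as ! i)"
        then have j: "j < r" using as i len unfolding iff by simp
        have "j + i * r < Suc i * r" using j by simp
        also have "\<dots> \<le> q * r" using i by (intro mult_le_mono1) simp
        finally have "d (j + i * r) = as ! i ! j"
          using j by (simp add: d_def c_def left_colors_def)
        moreover have "j < q * r" using j i less_le_trans[of j r "q * r"] by simp
        then have "d j = a ! j"
          using j by (simp add: d_def c_def left_colors_def a_def)
        moreover have "d (j + i * r) + int i * 0 = d j"
          by (rule shift_mult) (use as in \<open>simp add: iff\<close>)
        ultimately show "as ! i ! j = replicate q a ! i ! j" using i by simp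
      qed
    qed (use len in simp)
    with rep[OF this len(2)] as len show "as \<in>
      {replicate q a | a. length a = r \<and> alt_sum ((!) a) r = 0 \<and> palette a = {0, 1, 2, 3}}"
      unfolding iff by auto
  next
    assume "as \<in>
      {replicate q a | a. length a = r \<and> alt_sum ((!) a) r = 0 \<and> palette a = {0, 1, 2, 3}}"
    then obtain a where a: "as = replicate q a" "length a = r" "alt_sum ((!) a) r = 0"
      "palette a = {0, 1, 2, 3}" by blast
    have "length as = q" "\<forall>a \<in> set as. length a = r" using a(1,2) by auto
    then show "as \<in> A4 (int P) q r"
      using rep[OF a(1,2)] a(3,4) unfolding iff by metis
  qed
qed


section \<open>The tuples with exactly the colors 0, 1, 2, 3\<close>

text \<open>All reflections in the entries of a constant tuple fix its only entry.\<close>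

lemma alt_sum_const:
  assumes "\<And>i. i < m \<Longrightarrow> d i = x"
  shows "2 * alt_sum d m + (-1) ^ m * x = x"
  using assms by (induction m) (auto simp: algebra_simps)

text \<open>
  Two alternating sums whose lengths differ by 2 differ by a difference of neighbouring entries, so
  they are equal exactly when these entries are. With the even lengths, neighbours are paired from
  the start; with the odd lengths, the pairing starts one place later.
\<close>

lemma even_alt_sums_zero_iff:
  "(\<forall>m \<le> 2 * n. even m \<longrightarrow> alt_sum d m = 0) \<longleftrightarrow> (\<forall>i \<in> {1..n}. d (2 * i - 2) = d (2 * i - 1))"
proof (induction n)
  case (Suc n)
  have "(\<forall>m \<le> 2 * Suc n. even m \<longrightarrow> alt_sum d m = 0) \<longleftrightarrow>
      (\<forall>m \<le> 2 * n. even m \<longrightarrow> alt_sum d m = 0) \<and> alt_sum d (2 * Suc n) = 0"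
    by (auto simp: le_Suc_eq)
  also have "\<dots> \<longleftrightarrow> (\<forall>m \<le> 2 * n. even m \<longrightarrow> alt_sum d m = 0) \<and> d (2 * n) = d (2 * n + 1)"
    by (rule conj_cong) auto
  finally show ?case using Suc.IH by (simp add: atLeastAtMostSuc_conv conj_commute)
qed simp

lemma odd_alt_sums_eq_iff:
  "(\<forall>m < 2 * n + 2. odd m \<longrightarrow> alt_sum d m = e) \<longleftrightarrow>
    d 0 = e \<and> (\<forall>i \<in> {1..n}. d (2 * i - 1) = d (2 * i))"
proof (induction n)
  case 0
  have *: "m < 2 \<and> odd m \<longleftrightarrow> m = 1" for m :: nat by presburger
  have "(\<forall>m. m < 2 \<and> odd m \<longrightarrow> alt_sum d m = e) \<longleftrightarrow> d 0 = e" unfolding * by simp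
  then show ?case by (simp add: imp_conjL numeral_2_eq_2)
next
  case (Suc n)
  have *: "m < 2 * Suc n + 2 \<and> odd m \<longleftrightarrow> m < 2 * n + 2 \<and> odd m \<or> m = 2 * n + 3" for m
    by presburger
  have "(\<forall>m < 2 * Suc n + 2. odd m \<longrightarrow> alt_sum d m = e) \<longleftrightarrow>
      (\<forall>m < 2 * n + 2. odd m \<longrightarrow> alt_sum d m = e) \<and> alt_sum d (2 * n + 3) = e"
    unfolding imp_conjL[symmetric] * by blast
  also have "\<dots> \<longleftrightarrow> (\<forall>m < 2 * n + 2. odd m \<longrightarrow> alt_sum d m = e) \<and> d (2 * n + 1) = d (2 * n + 2)"
    by (rule conj_cong) (auto simp: numeral_3_eq_3)
  finally show ?case using Suc.IH by (auto simp: atLeastAtMostSuc_conv)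
qed

text \<open>The common form of \<open>A4_01\<close> and \<open>A4_23\<close>, which the symmetry \<open>x \<mapsto> 3 - x\<close> interchanges.\<close>

definition inner_paired :: "int \<Rightarrow> int \<Rightarrow> nat \<Rightarrow> int list set" where
  "inner_paired e f r = {a. length a = r \<and> set a \<subseteq> {e, f} \<and> entry a 1 = e \<and> entry a r = e \<and>
     (\<forall>i \<in> {1..r div 2 - 1}. entry a (2 * i) = entry a (2 * i + 1))}"

lemma A4_01_inner_paired: "A4_01 r = inner_paired 1 0 r"
  and A4_23_inner_paired: "A4_23 r = inner_paired 2 3 r"
  unfolding A4_01_def A4_23_def inner_paired_def by (auto simp: insert_commute)

lemma inner_paired_iff:
  assumes a: "length a = r" "even r" "r \<ge> 2"
  shows "a \<in> inner_paired e f r \<longleftrightarrow>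
    set a \<subseteq> {e, f} \<and> (\<forall>m < r. odd m \<longrightarrow> alt_sum ((!) a) m = e) \<and> alt_sum ((!) a) r = 0"
proof -
  obtain n where r: "r = 2 * n + 2"
    using a(2,3) by (metis add.commute evenE le_Suc_ex mult_2 even_add dvd_refl)
  have "alt_sum ((!) a) r = alt_sum ((!) a) (r - 1) - a ! (r - 1)"
    using r by simp
  moreover have "odd (r - 1)" "r - 1 < r" using r by auto
  ultimately have last: "(\<forall>m < r. odd m \<longrightarrow> alt_sum ((!) a) m = e) \<longrightarrow>
      (alt_sum ((!) a) r = 0 \<longleftrightarrow> entry a r = e)"
    by auto
  have "(\<forall>m < r. odd m \<longrightarrow> alt_sum ((!) a) m = e) \<longleftrightarrow>
      entry a 1 = e \<and> (\<forall>i \<in> {1..r div 2 - 1}. entry a (2 * i) = entry a (2 * i + 1))"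
    using odd_alt_sums_eq_iff[of n "(!) a" e] by (simp add: r)
  then show ?thesis
    using a(1) last unfolding inner_paired_def mem_Collect_eq by argo
qed

lemma A4_12_iff:
  assumes a: "length a = r" "even r"
  shows "a \<in> A4_12 r \<longleftrightarrow> set a \<subseteq> {1, 2} \<and> (\<forall>m \<le> r. even m \<longrightarrow> alt_sum ((!) a) m = 0)"
proof -
  have "2 * (r div 2) = r" using a(2) by simp
  moreover have "2 * i - 1 - 1 = 2 * i - 2" for i :: nat by simp
  ultimately show ?thesis
    using a(1) even_alt_sums_zero_iff[of "r div 2" "(!) a"] unfolding A4_12_def by simp
qed

lemma replicate_if_all_eq: "set a \<subseteq> {x} \<Longrightarrow> length a = r \<Longrightarrow> a = replicate r x"
  by (metis replicate_eqI singletonD subsetD)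

text \<open>
  An entry at an even index is the alternating sum that ends with it; an entry at an odd index is
  cancelled by the next step, so it is the alternating sum just before it.
\<close>

lemma odd_alt_sum_entry:
  assumes "\<And>m. m \<le> r \<Longrightarrow> even m \<Longrightarrow> alt_sum ((!) a) m = 0"
    and a: "length a = r" "even r" "y \<in> set a"
  obtains m where "m < r" "odd m" "alt_sum ((!) a) m = y"
proof -
  obtain i where i: "i < r" "y = a ! i" using a by (auto simp: in_set_conv_nth)
  show ?thesis
  proof (cases "even i")
    case True
    then have "i + 1 < r" using i a(2) by (metis Suc_eq_plus1 Suc_lessI even_Suc)
    then show ?thesis using that[of "i + 1"] True i assms(1)[of i] by simp
  next
    case False
    then have "alt_sum ((!) a) (Suc i) = 0" using i by (intro assms(1)) auto
    then show ?thesis using that[of i] False i by simp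
  qed
qed

lemma palette_memD:
  assumes "palette a \<subseteq> S" "m < length a" "x \<in> set a"
  shows "even m \<Longrightarrow> 2 * alt_sum ((!) a) m + x \<in> S" "odd m \<Longrightarrow> 2 * alt_sum ((!) a) m - x \<in> S"
  using assms unfolding palette_def by force+

lemma palette_memI:
  assumes "m < length a" "x \<in> set a"
  shows "even m \<Longrightarrow> y = 2 * alt_sum ((!) a) m + x \<Longrightarrow> y \<in> palette a"
    "odd m \<Longrightarrow> y = 2 * alt_sum ((!) a) m - x \<Longrightarrow> y \<in> palette a"
  using assms unfolding palette_def by force+

lemma mem_0123_iff: "(z :: int) \<in> {0, 1, 2, 3} \<longleftrightarrow> 0 \<le> z \<and> z \<le> 3"
  by auto

text \<open>
  Take entries \<open>x < y\<close>. If the alternating sums of even length vanish, all reflections \<open>2 u - v\<close> of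
  entries lie between 0 and 3; from \<open>2 x - y \<ge> 0\<close> and \<open>2 y - x \<le> 3\<close> follows \<open>x = 1\<close> and \<open>y = 2\<close>.
  Otherwise a translation by \<open>2\<close> or \<open>-2\<close> keeps the entries between 0 and 3, so they fill one half of
  this range, and a reflection of both \<open>x\<close> and \<open>y\<close> into the range has only one possible centre.
\<close>

lemma palette_necessary:
  assumes a: "length a = r" "even r" "r \<ge> 2"
    and 0: "alt_sum ((!) a) r = 0" and pal: "palette a = {0, 1, 2, 3}"
  shows "a \<in> inner_paired 1 0 r \<union> A4_12 r \<union> inner_paired 2 3 r \<and> (\<forall>x. a \<noteq> replicate r x)"
proof -
  let ?D = "alt_sum ((!) a)"
  have nonconst: "a \<noteq> replicate r x" for x
  proof
    assume "a = replicate r x"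
    then have "2 * ?D m + (-1) ^ m * x = x" if "m < r" for m
      using that by (intro alt_sum_const) simp
    then have "palette a \<subseteq> {x}"
      using a \<open>a = replicate r x\<close> unfolding palette_def by auto
    then show False using pal by auto
  qed
  then obtain x y where xy: "x \<in> set a" "y \<in> set a" "x < y"
  proof -
    have "a ! 0 \<in> set a" using a by simp
    moreover obtain z where "z \<in> set a" "z \<noteq> a ! 0"
      using nonconst[of "a ! 0"] replicate_if_all_eq[OF _ a(1), of "a ! 0"] by blast
    ultimately show thesis using that[of z "a ! 0"] that[of "a ! 0" z] by linarith
  qed
  have ev: "0 \<le> 2 * ?D m + z" "2 * ?D m + z \<le> 3" if "m < r" "even m" "z \<in> set a" for m z
    using palette_memD(1)[of a "{0, 1, 2, 3}" m z] that pal a(1) unfolding mem_0123_iff by auto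
  have od: "0 \<le> 2 * ?D m - z" "2 * ?D m - z \<le> 3" if "m < r" "odd m" "z \<in> set a" for m z
    using palette_memD(2)[of a "{0, 1, 2, 3}" m z] that pal a(1) unfolding mem_0123_iff by auto
  have range: "0 \<le> z \<and> z \<le> 3" if "z \<in> set a" for z
    using ev[of 0 z] that a(3) by simp
  show ?thesis
  proof (cases "\<forall>m < r. even m \<longrightarrow> ?D m = 0")
    case True
    then have D0: "?D m = 0" if "m \<le> r" "even m" for m
      using that 0 by (cases "m = r") auto
    have bd: "0 \<le> 2 * u - v \<and> 2 * u - v \<le> 3" if u: "u \<in> set a" and v: "v \<in> set a" for u v
    proof -
      obtain m where "m < r" "odd m" "?D m = u"
        using odd_alt_sum_entry[OF D0 a(1,2) u] by blast
      then show ?thesis using od v by blast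
    qed
    have "x = 1" "y = 2"
      using bd[OF xy(1,2)] bd[OF xy(2,1)] xy(3) by linarith+
    then have "z \<in> {1, 2}" if "z \<in> set a" for z
      using bd[OF xy(1) that] bd[OF xy(2) that] bd[OF that xy(1)] by auto
    then have "a \<in> A4_12 r"
      unfolding A4_12_iff[OF a(1,2)] using D0 by auto
    then show ?thesis using nonconst by blast
  next
    case False
    then obtain m where m: "m < r" "even m" "?D m \<noteq> 0" by blast
    then have "?D m = 1 \<or> ?D m = -1"
      using ev[OF m(1,2) xy(1)] range[OF xy(1)] by linarith
    then show ?thesis
    proof
      assume "?D m = 1"
      then have 01: "z \<in> {0, 1}" if "z \<in> set a" for z
        using ev[OF m(1,2) that] range[OF that] by auto
      then have "x = 0" "y = 1" using 01[OF xy(1)] 01[OF xy(2)] xy(3) by auto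
      then have "?D k = 1" if "k < r" "odd k" for k
        using od[OF that xy(1)] od[OF that xy(2)] by linarith
      then have "a \<in> inner_paired 1 0 r"
        unfolding inner_paired_iff[OF a] using 01 0 by auto
      then show ?thesis using nonconst by blast
    next
      assume "?D m = -1"
      then have 23: "z \<in> {2, 3}" if "z \<in> set a" for z
        using ev[OF m(1,2) that] range[OF that] by auto
      then have "x = 2" "y = 3" using 23[OF xy(1)] 23[OF xy(2)] xy(3) by auto
      then have "?D k = 2" if "k < r" "odd k" for k
        using od[OF that xy(1)] od[OF that xy(2)] by linarith
      then have "a \<in> inner_paired 2 3 r"
        unfolding inner_paired_iff[OF a] using 23 0 by auto
      then show ?thesis using nonconst by blast
    qed
  qed
qed

text \<open>
  Without translation the entries give \<open>e\<close> and \<open>f\<close>; a translation by \<open>2 * (e - f)\<close> gives the other two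
  colors, and it occurs because \<open>f\<close> does. The reflections all have centre \<open>e\<close> and
  stay in the range.
\<close>

lemma palette_inner_paired:
  assumes a: "length a = r" "even r" "r \<ge> 2"
    and ef: "e = 1 \<and> f = 0 \<or> e = 2 \<and> f = 3"
    and paired: "a \<in> inner_paired e f r" and nonconst: "a \<noteq> replicate r e"
  shows "palette a = {0, 1, 2, 3}"
proof -
  let ?D = "alt_sum ((!) a)"
  have S: "set a \<subseteq> {e, f}" and od: "\<And>m. m < r \<Longrightarrow> odd m \<Longrightarrow> ?D m = e" and 0: "?D r = 0"
    using paired unfolding inner_paired_iff[OF a] by auto
  have ev: "?D (Suc m) = e - a ! m" if "m < r" "odd m" for m
    using that od[OF that] by simp
  have "a ! 0 = e" using od[of 1] a(3) by simp
  then have e: "e \<in> set a" using a nth_mem[of 0 a] by simp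
  have f: "f \<in> set a" using nonconst S replicate_if_all_eq[OF _ a(1), of e] by blast
  \<comment> \<open>An entry \<open>f\<close> at an odd index \<open>k\<close> makes the alternating sum of length \<open>k + 1\<close> equal to
    \<open>e - f\<close>. Every entry \<open>f\<close> at an even index has an equal partner just before it.\<close>
  obtain k where k: "k < r" "odd k" "a ! k = f"
  proof -
    obtain i where i: "i < r" "a ! i = f" using f a(1) by (auto simp: in_set_conv_nth)
    show thesis
    proof (cases "even i")
      case True
      have "i \<noteq> 0"
      proof
        assume "i = 0"
        then show False using i \<open>a ! 0 = e\<close> ef by auto
      qed
      then have o: "odd (i - 1)" "i - 1 < r" "Suc (i - 1) = i" using True i by auto
      have "i + 1 < r" using True i a(2) by (metis Suc_eq_plus1 Suc_lessI even_Suc)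
      then have "?D (Suc i) = e" using True by (intro od) auto
      then have "?D i = e - a ! i" using True by simp
      then have "a ! (i - 1) = f" using ev[OF o(2,1)] o(3) i by simp
      then show ?thesis using that o by blast
    qed (use i that in blast)
  qed
  have "k + 1 < r"
  proof (rule ccontr)
    assume "\<not> k + 1 < r"
    then have "Suc k = r" using k by simp
    then show False using ev[OF k(1,2)] k(3) 0 ef by auto
  qed
  then have "{e, f, 2 * (e - f) + e, 2 * (e - f) + f} \<subseteq> palette a"
    using palette_memI(1)[of 0 a e] palette_memI(1)[of 0 a f]
      palette_memI(1)[of "k + 1" a e] palette_memI(1)[of "k + 1" a f] e f ev[OF k(1,2)] k a by auto
  then have "{0, 1, 2, 3} \<subseteq> palette a" using ef by auto
  moreover have "palette a \<subseteq> {0, 1, 2, 3}"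
  proof
    fix y assume "y \<in> palette a"
    then obtain m x where y: "y = 2 * ?D m + (-1) ^ m * x" "m < r" "x \<in> set a"
      using a(1) unfolding palette_def by blast
    have x: "x = e \<or> x = f" using S y by blast
    show "y \<in> {0, 1, 2, 3}"
    proof (cases "odd m")
      case True
      then show ?thesis using od[of m] y x ef by auto
    next
      case False
      have "?D m = 0 \<or> ?D m = e - f"
      proof (cases "m = 0")
        case False
        then have m: "m - 1 < r" "odd (m - 1)" "Suc (m - 1) = m"
          using \<open>\<not> odd m\<close> y by auto
        have "a ! (m - 1) \<in> {e, f}" using m a(1) S nth_mem by blast
        then show ?thesis using ev[OF m(1,2)] m(3) by auto
      qed simp
      then show ?thesis using False y x ef by auto
    qed
  qed
  ultimately show ?thesis by blast
qed

text \<open>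
  The entries give 1 and 2. Both are also centres of reflections, which yields \<open>0 = 2 * 1 - 2\<close> and
  \<open>3 = 2 * 2 - 1\<close>.
\<close>

lemma palette_A4_12:
  assumes a: "length a = r" "even r" "r \<ge> 2"
    and a12: "a \<in> A4_12 r" and nonconst: "a \<noteq> replicate r 1" "a \<noteq> replicate r 2"
  shows "palette a = {0, 1, 2, 3}"
proof -
  let ?D = "alt_sum ((!) a)"
  have S: "set a \<subseteq> {1, 2}" and ev: "\<And>m. m \<le> r \<Longrightarrow> even m \<Longrightarrow> ?D m = 0"
    using a12 unfolding A4_12_iff[OF a(1,2)] by auto
  have mem: "1 \<in> set a" "2 \<in> set a"
    using nonconst S replicate_if_all_eq[OF _ a(1)] by blast+
  obtain k where k: "k < r" "odd k" "?D k = 1"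
    using odd_alt_sum_entry[OF ev a(1,2) mem(1)] by blast
  obtain l where l: "l < r" "odd l" "?D l = 2"
    using odd_alt_sum_entry[OF ev a(1,2) mem(2)] by blast
  have "{1, 2, 2 * 1 - 2, 2 * 2 - 1} \<subseteq> palette a"
    using palette_memI(1)[of 0 a 1] palette_memI(1)[of 0 a 2]
      palette_memI(2)[of k a 2] palette_memI(2)[of l a 1] mem k l a by auto
  then have "{0, 1, 2, 3} \<subseteq> palette a" by auto
  moreover have "palette a \<subseteq> {0, 1, 2, 3}"
  proof
    fix y assume "y \<in> palette a"
    then obtain m x where y: "y = 2 * ?D m + (-1) ^ m * x" "m < r" "x \<in> set a"
      using a(1) unfolding palette_def by blast
    have x: "x = 1 \<or> x = 2" using S y by blast
    show "y \<in> {0, 1, 2, 3}"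
    proof (cases "odd m")
      case True
      then have "?D (Suc m) = 0" using y(2) by (intro ev) auto
      then have "?D m = a ! m" using True by simp
      moreover have "a ! m \<in> {1, 2}" using y(2) a(1) S nth_mem by blast
      ultimately show ?thesis using True y x by auto
    next
      case False
      then show ?thesis using ev[of m] y x by auto
    qed
  qed
  ultimately show ?thesis by blast
qed

lemma palette_eq_iff:
  assumes a: "length a = r" "even r" "r \<ge> 2"
  shows "alt_sum ((!) a) r = 0 \<and> palette a = {0, 1, 2, 3} \<longleftrightarrow>
    a \<in> A4_01 r \<union> A4_12 r \<union> A4_23 r \<and> a \<noteq> replicate r 1 \<and> a \<noteq> replicate r 2" (is "?L \<longleftrightarrow> ?R")
proof
  assume ?L
  then show ?R
    using palette_necessary[OF a] unfolding A4_01_inner_paired A4_23_inner_paired by blast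
next
  assume R: ?R
  then have "palette a = {0, 1, 2, 3}"
    using palette_inner_paired[OF a, of 1 0] palette_inner_paired[OF a, of 2 3] palette_A4_12[OF a]
    unfolding A4_01_inner_paired A4_23_inner_paired by blast
  moreover have "alt_sum ((!) a) r = 0"
    using R inner_paired_iff[OF a] A4_12_iff[OF a(1,2)] a(2)
    unfolding A4_01_inner_paired A4_23_inner_paired by blast
  ultimately show ?L by blast
qed

theorem proposition4p4:
  fixes p :: int and q r :: nat
  assumes "p \<noteq> 0" and "coprime p (int q)" and "\<bar>p\<bar> \<ge> int q" and "q \<ge> 1"
    and "r \<ge> 2" and "even r"
  shows "A4 p q r =
    {replicate q a | a. a \<in> A4_01 r \<union> A4_12 r \<union> A4_23 r}
      - {replicate q (replicate r 1), replicate q (replicate r 2)}"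
proof -
  define P where "P = nat \<bar>p\<bar>"
  have P: "\<bar>p\<bar> = int P" "P \<ge> 1" using assms(1) by (auto simp: P_def)
  have "coprime (int P) (int q)" using assms(2) unfolding P(1)[symmetric] by simp
  then have cop: "coprime P q" by simp
  have len: "length a = r" if "a \<in> A4_01 r \<union> A4_12 r \<union> A4_23 r" for a
    using that by (auto simp: A4_01_def A4_12_def A4_23_def)
  have inj: "replicate q a = replicate q a' \<longleftrightarrow> a = a'" for a a' :: "int list"
    using assms(4) by simp
  have "A4 p q r = A4 (int P) q r"
    using A4_abs[of p r q] assms P(1) by simp
  also have "\<dots> = {replicate q a | a. length a = r \<and> alt_sum ((!) a) r = 0 \<and> palette a = {0, 1, 2, 3}}"
    using A4_positive[OF cop P(2) assms(4,6,5)] .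
  also have "\<dots> = {replicate q a | a. a \<in> A4_01 r \<union> A4_12 r \<union> A4_23 r \<and>
      a \<noteq> replicate r 1 \<and> a \<noteq> replicate r 2}"
    using palette_eq_iff[OF _ assms(6,5)] len by blast
  also have "\<dots> = {replicate q a | a. a \<in> A4_01 r \<union> A4_12 r \<union> A4_23 r}
      - {replicate q (replicate r 1), replicate q (replicate r 2)}"
    using inj by auto
  finally show ?thesis .
qed

end
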